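(* Let $X_1,\dots,X_m$ be pointed spaces, and regard $(\Sigma X_i,* )$, $1\le i\le m$, as power couples via the suspension structure. Let $\sigma=\{i_1<\dots<i_k\}\in\Delta^{m-1}$ with $k\ge2$, and let $c$ be a power sequence such that $c_i^{\{i\}}=1$ for all $i\in\sigma$. Then $\eta(\partial\sigma)\circ\phi_k\colon\Sigma^{k-1}(X_{i_1}\wedge\dots\wedge X_{i_k})\to(\underline{\Sigma X},\underline{*})^{\partial\sigma,c}$ is a higher Whitehead product in $\big[c_{i_1}^\sigma\imath_{i_1},\dots,c_{i_k}^\sigma\imath_{i_k}\big]$.
   Context: Conventions. Spaces are compactly generated, products are taken in that category, and maps are pointed. $\mathbb{N}=\{1,2,\dots\}$, $[m]=\{1,\dots,m\}$, $\Delta^{m-1}$ is the simplicial complex of all subsets of $[m]$ including $\emptyset$. Power couples. A pair $(X,A)$ is a pointed space $X$ with a subspace $A$ containing the basepoint. A power couple is a pair with maps of pairs $\rho_a\colon(X,A)\to(X,A)$, $a\in\mathbb{N}$, such that $\rho_1=\mathrm{id}$ and $\rho_a\circ\rho_b=\rho_{ab}$. On $\Sigma X=S^1\wedge X$ the suspension structure gives $\rho_a(e^{it}\wedge x)=e^{ait}\wedge x$. Polyhedral products. $(\underline{Z},\underline{A})^\sigma=\{(z_i)\in\prod_i Z_i\mid z_i\in A_i\text{ if }i\notin\sigma\}$ and $(\underline{Z},\underline{A})^K=\bigcup_{\sigma\in K}(\underline{Z},\underline{A})^\sigma$ for a sequence of power couples $(Z_i,A_i)$; here $Z_i=\Sigma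 X_i$, $A_i=*$. Power sequences. A power sequence is a map $c\colon\Delta^{m-1}\to\mathbb{N}^m$, $\sigma\mapsto(c_1^\sigma,\dots,c_m^\sigma)$, with $c_i^\sigma=1$ for $i\notin\sigma$ and $c_i^\tau\mid c_i^\sigma$ whenever $\tau\subseteq\sigma$. For $\tau\subseteq\sigma$, $\underline{c}^{\sigma/\tau}$ is the self-map of any $(\underline{Z},\underline{A})^K$ obtained by restricting $\prod_i\rho_{c_i^\sigma/c_i^\tau}$. Weighted polyhedral products. Spaces $(\underline{Z},\underline{A})^{\sigma,c}$ and maps $\eta(\sigma)\colon(\underline{Z},\underline{A})^\sigma\to(\underline{Z},\underline{A})^{\sigma,c}$ are defined by induction on $|\sigma|$, forming a functor on the face poset. First, $(\underline{Z},\underline{A})^{\emptyset,c}=\prod_i A_i$, $\eta(\emptyset)=\mathrm{id}$. For $|\sigma|\ge1$, $(\underline{Z},\underline{A})^{\partial\sigma,c}=\mathrm{colim}_{\tau\subsetneq\sigma}(\underline{Z},\underline{A})^{\tau,c}$, the map $\eta(\partial\sigma)\colon(\underline{Z},\underline{A})^{\partial\sigma}\to(\underline{Z},\underline{A})^{\partial\sigma,c}$ is induced by the composites $(\underline{Z},\underline{A})^\tau\xrightarrow{\underline{c}^{\sigma/\tau}}(\underline{Z},\underline{A})^\tau\xrightarrow{\eta(\tau)}(\underline{Z},\underline{A})^{\tau,c}\to(\underline{Z},\underline{A})^{\partial\sigma,c}$ over $\tau\subsetneq\sigma$, and $(\underline{Z},\underline{A})^{\sigma,c}$ is the pushout of the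 inclusion $(\underline{Z},\underline{A})^{\partial\sigma}\to(\underline{Z},\underline{A})^\sigma$ and $\eta(\partial\sigma)$, with $\eta(\sigma)$ the map from $(\underline{Z},\underline{A})^\sigma$. Thus $(\underline{\Sigma X},\underline{*})^{\{i\},c}=\Sigma X_i$, and for $i\in\sigma$ we write $\imath_i\colon\Sigma X_i=(\underline{\Sigma X},\underline{*})^{\{i\},c}\to(\underline{\Sigma X},\underline{*})^{\partial\sigma,c}$ for the map into the colimit; $a\,\imath_i$ denotes $\imath_i\circ\rho_a$. Higher Whitehead products. $FW(\Sigma X_{i_1},\dots,\Sigma X_{i_k})$ is the fat wedge, the subspace of $\prod_s\Sigma X_{i_s}$ of points with at least one coordinate $*$; it equals $(\underline{\Sigma X},\underline{*})^{\partial\sigma}$. For $k\ge2$, $\phi_k\colon\Sigma^{k-1}(X_{i_1}\wedge\dots\wedge X_{i_k})\to FW(\Sigma X_{i_1},\dots,\Sigma X_{i_k})$ is (Porter's) universal higher Whitehead product, a map fitting in a homotopy cofibration $\Sigma^{k-1}(X_{i_1}\wedge\dots\wedge X_{i_k})\xrightarrow{\phi_k}FW(\Sigma X_{i_1},\dots,\Sigma X_{i_k})\to\Sigma X_{i_1}\times\dots\times\Sigma X_{i_k}$. Given pointed maps $f_s\colon\Sigma X_{i_s}\to Y$, a higher Whitehead product of $f_1,\dots,f_k$ is a composite $f\circ\phi_k$ where $f\colon FW(\Sigma X_{i_1},\dots,\Sigma X_{i_k})\to Y$ extends $\bigvee_s f_s\colon\bigvee_s\Sigma X_{i_s}\to Y$;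 $[f_1,\dots,f_k]$ denotes the set of all of them. *)

theory Defs
  imports "HOL-Analysis.Analysis"
begin

section \<open>Compactly generated pointed spaces\<close>

text \<open>Compactly generated means \<^const>\<open>k_space\<close>; no separation axiom is imposed. Products and
  subspaces are formed in the category of k-spaces, by \<^const>\<open>kification\<close>. Colimits, quotients
  and products with the unit interval of k-spaces are k-spaces already.\<close>

type_synonym 'a pointed = "'a topology \<times> 'a"

definition pointed_space :: "'a pointed \<Rightarrow> bool" where
  "pointed_space X \<longleftrightarrow> k_space (fst X) \<and> snd X \<in> topspace (fst X)"

definition pointed_map :: "'a pointed \<Rightarrow> 'b pointed \<Rightarrow> ('a \<Rightarrow> 'b) \<Rightarrow> bool" where
  "pointed_map X Y f \<longleftrightarrow> continuous_map (fst X) (fst Y) f \<and> f (snd X) = snd Y"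

definition cg_prod :: "'a topology \<Rightarrow> 'b topology \<Rightarrow> ('a \<times> 'b) topology" where
  "cg_prod X Y = kification (prod_topology X Y)"

definition cg_product :: "'i set \<Rightarrow> ('i \<Rightarrow> 'a topology) \<Rightarrow> ('i \<Rightarrow> 'a) topology" where
  "cg_product I X = kification (product_topology X I)"

definition cg_subspace :: "'a topology \<Rightarrow> 'a set \<Rightarrow> 'a topology" where
  "cg_subspace X S = kification (subtopology X S)"

definition pointed_product :: "'i set \<Rightarrow> ('i \<Rightarrow> 'a pointed) \<Rightarrow> ('i \<Rightarrow> 'a) pointed" where
  "pointed_product I X = (cg_product I (\<lambda>i. fst (X i)), \<lambda>i\<in>I. snd (X i))"


section \<open>Quotients, pushouts and colimits\<close>

text \<open>The quotient topology on \<open>q ` topspace X\<close>. For injective \<open>q\<close> this is a homeomorphic copy of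
  \<open>X\<close>, which serves to change the type of points.\<close>

definition quotient_topology :: "'a topology \<Rightarrow> ('a \<Rightarrow> 'b) \<Rightarrow> 'b topology" where
  "quotient_topology X q =
     topology (\<lambda>U. U \<subseteq> q ` topspace X \<and> openin X {x \<in> topspace X. q x \<in> U})"

lemma openin_quotient_topology:
  "openin (quotient_topology X q) U \<longleftrightarrow>
     U \<subseteq> q ` topspace X \<and> openin X {x \<in> topspace X. q x \<in> U}"
proof -
  have "istopology (\<lambda>U. U \<subseteq> q ` topspace X \<and> openin X {x \<in> topspace X. q x \<in> U})"
  proof -
    have 1: "{x \<in> topspace X. q x \<in> S \<inter> T} = {x \<in> topspace X. q x \<in> S} \<inter> {x \<in> topspace X. q x \<in> T}" for S T
      by auto
    have 2: "{x \<in> topspace X. q x \<in> \<Union>\<K>} = (\<Union>K\<in>\<K>. {x \<in> topspace X. q x \<in> K})" for \<K>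
      by auto
    show ?thesis
      unfolding istopology_def 1 2 by blast
  qed
  then show ?thesis
    by (simp add: quotient_topology_def topology_inverse')
qed

lemma topspace_quotient_topology [simp]: "topspace (quotient_topology X q) = q ` topspace X"
proof -
  have "{x \<in> topspace X. q x \<in> q ` topspace X} = topspace X"
    by auto
  then have "openin (quotient_topology X q) (q ` topspace X)"
    by (simp add: openin_quotient_topology)
  then show ?thesis
    by (meson openin_quotient_topology openin_subset openin_topspace subset_antisym)
qed

lemma quotient_map_quotient_topology: "quotient_map X (quotient_topology X q) q"
  by (simp add: quotient_map_def openin_quotient_topology)

text \<open>A representative, chosen once for each class of the equivalence relation generated by \<open>R\<close>;
  quotients by \<open>R\<close> are modelled on these representatives.\<close>

definition glue :: "('a \<times> 'a) set \<Rightarrow> 'a \<Rightarrow> 'a" where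
  "glue R x = (SOME y. (x, y) \<in> (R \<union> R\<inverse>)\<^sup>*)"

lemma glue_eq_iff: "glue R x = glue R y \<longleftrightarrow> (x, y) \<in> (R \<union> R\<inverse>)\<^sup>*"
proof -
  have sym: "sym ((R \<union> R\<inverse>)\<^sup>*)"
    by (simp add: sym_Un_converse sym_rtrancl)
  have rep: "(x, glue R x) \<in> (R \<union> R\<inverse>)\<^sup>*" for x
    unfolding glue_def by (rule someI[of _ x]) simp
  show ?thesis
  proof
    assume "glue R x = glue R y"
    with rep[of x] rep[of y] sym show "(x, y) \<in> (R \<union> R\<inverse>)\<^sup>*"
      by (metis rtrancl_trans symD)
  next
    assume "(x, y) \<in> (R \<union> R\<inverse>)\<^sup>*"
    with sym have "(x, z) \<in> (R \<union> R\<inverse>)\<^sup>* \<longleftrightarrow> (y, z) \<in> (R \<union> R\<inverse>)\<^sup>*" for z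
      by (meson rtrancl_trans symD)
    then show "glue R x = glue R y"
      by (simp add: glue_def)
  qed
qed

definition coprod_topology :: "'a topology \<Rightarrow> 'b topology \<Rightarrow> ('a + 'b) topology" where
  "coprod_topology X Y =
     topology (\<lambda>U. openin X (Inl -` U) \<and> openin Y (Inr -` U))"

lemma openin_coprod_topology:
  "openin (coprod_topology X Y) U \<longleftrightarrow> openin X (Inl -` U) \<and> openin Y (Inr -` U)"
proof -
  have "istopology (\<lambda>U. openin X (Inl -` U) \<and> openin Y (Inr -` U))"
    unfolding istopology_def by (auto simp: vimage_Union)
  then show ?thesis
    by (simp add: coprod_topology_def topology_inverse')
qed

definition pushout_rel :: "'a set \<Rightarrow> ('a \<Rightarrow> 'b) \<Rightarrow> ('a \<Rightarrow> 'c) \<Rightarrow> (('b + 'c) \<times> ('b + 'c)) set" where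
  "pushout_rel A i f = {(Inl (i a), Inr (f a)) | a. a \<in> A}"

text \<open>The pushout of \<open>X \<leftarrow> A \<rightarrow> Y\<close> along \<open>i\<close> and \<open>f\<close>; only the points of \<open>A\<close> matter.\<close>

definition pushout ::
  "'b topology \<Rightarrow> 'a set \<Rightarrow> ('a \<Rightarrow> 'b) \<Rightarrow> ('a \<Rightarrow> 'c) \<Rightarrow> 'c topology \<Rightarrow> ('b + 'c) topology" where
  "pushout X A i f Y = quotient_topology (coprod_topology X Y) (glue (pushout_rel A i f))"

definition colim_rel ::
  "('i::order) set \<Rightarrow> ('i \<Rightarrow> 'a topology) \<Rightarrow> ('i \<Rightarrow> 'i \<Rightarrow> 'a \<Rightarrow> 'a) \<Rightarrow> (('i \<times> 'a) \<times> ('i \<times> 'a)) set" where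
  "colim_rel I D d = {((i, x), (j, d i j x)) | i j x. i \<in> I \<and> j \<in> I \<and> i \<le> j \<and> x \<in> topspace (D i)}"

text \<open>The colimit of the diagram with objects \<open>D i\<close> and maps \<open>d i j : D i \<rightarrow> D j\<close> for \<open>i \<le> j\<close>.\<close>

definition colim ::
  "('i::order) set \<Rightarrow> ('i \<Rightarrow> 'a topology) \<Rightarrow> ('i \<Rightarrow> 'i \<Rightarrow> 'a \<Rightarrow> 'a) \<Rightarrow> ('i \<times> 'a) topology" where
  "colim I D d = quotient_topology (sum_topology D I) (glue (colim_rel I D d))"


section \<open>Smash products and suspensions\<close>

text \<open>\<open>collapse A a\<close> is the projection onto \<open>X/A\<close>, whose points are modelled as those of \<open>X - A\<close>
  together with \<open>a \<in> A\<close>.\<close>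

definition collapse :: "'a set \<Rightarrow> 'a \<Rightarrow> 'a \<Rightarrow> 'a" where
  "collapse A a x = (if x \<in> A then a else x)"

definition smash_pt :: "'a pointed \<Rightarrow> 'b pointed \<Rightarrow> 'a \<times> 'b \<Rightarrow> 'a \<times> 'b" where
  "smash_pt X Y = collapse {(x, y). x = snd X \<or> y = snd Y} (snd X, snd Y)"

definition smash :: "'a pointed \<Rightarrow> 'b pointed \<Rightarrow> ('a \<times> 'b) pointed" where
  "smash X Y = (quotient_topology (cg_prod (fst X) (fst Y)) (smash_pt X Y), (snd X, snd Y))"

definition big_smash :: "'i set \<Rightarrow> ('i \<Rightarrow> 'a pointed) \<Rightarrow> ('i \<Rightarrow> 'a) pointed" where
  "big_smash I X = (let P = pointed_product I X in
     (quotient_topology (fst P) (collapse {x. \<exists>i\<in>I. x i = snd (X i)} (snd P)), snd P))"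

definition circle :: "complex pointed" where
  "circle = (top_of_set (sphere 0 1), 1)"

definition susp :: "'a pointed \<Rightarrow> (complex \<times> 'a) pointed" where
  "susp X = smash circle X"

text \<open>\<open>\<Sigma>\<^sup>n Y\<close>, with the \<open>n\<close> successive suspension coordinates collected in a list so that
  the type of points does not depend on \<open>n\<close>.\<close>

primrec iter_susp :: "nat \<Rightarrow> 'a pointed \<Rightarrow> (complex list \<times> 'a) pointed" where
  "iter_susp 0 Y = (quotient_topology (fst Y) (\<lambda>y. ([], y)), ([], snd Y))"
| "iter_susp (Suc n) Y =
     (let S = susp (iter_susp n Y); e = (\<lambda>(z, (zs, y)). (z # zs, y))
      in (quotient_topology (fst S) e, e (snd S)))"


section \<open>Homotopy cofibrations\<close>

definition pointed_homotopic :: "'a pointed \<Rightarrow> 'b pointed \<Rightarrow> ('a \<Rightarrow> 'b) \<Rightarrow> ('a \<Rightarrow> 'b) \<Rightarrow> bool" where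
  "pointed_homotopic X Y = homotopic_with (\<lambda>h. h (snd X) = snd Y) (fst X) (fst Y)"

definition pointed_homotopy_equivalence :: "'a pointed \<Rightarrow> 'b pointed \<Rightarrow> ('a \<Rightarrow> 'b) \<Rightarrow> bool" where
  "pointed_homotopy_equivalence X Y f \<longleftrightarrow> pointed_map X Y f \<and>
     (\<exists>g. pointed_map Y X g \<and> pointed_homotopic X X (g \<circ> f) id \<and> pointed_homotopic Y Y (f \<circ> g) id)"

text \<open>The reduced cone has its apex at parameter \<open>1\<close>; its base is at parameter \<open>0\<close>.\<close>

definition interval :: "real pointed" where
  "interval = (top_of_set {0..1}, 1)"

definition reduced_cone :: "'a pointed \<Rightarrow> (real \<times> 'a) pointed" where
  "reduced_cone A = smash interval A"

definition reduced_cone_base :: "'a pointed \<Rightarrow> 'a \<Rightarrow> real \<times> 'a" where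
  "reduced_cone_base A a = smash_pt interval A (0, a)"

definition mapping_cone_in :: "'a pointed \<Rightarrow> ('a \<Rightarrow> 'b) \<Rightarrow> 'b \<Rightarrow> (real \<times> 'a) + 'b" where
  "mapping_cone_in A f b = glue (pushout_rel (topspace (fst A)) (reduced_cone_base A) f) (Inr b)"

definition mapping_cone :: "'a pointed \<Rightarrow> 'b pointed \<Rightarrow> ('a \<Rightarrow> 'b) \<Rightarrow> ((real \<times> 'a) + 'b) pointed" where
  "mapping_cone A B f =
     (pushout (fst (reduced_cone A)) (topspace (fst A)) (reduced_cone_base A) f (fst B),
      mapping_cone_in A f (snd B))"

text \<open>\<open>A \<rightarrow> B \<rightarrow> C\<close> is a homotopy cofibration if \<open>g\<close> extends to a homotopy equivalence from the
  mapping cone of \<open>f\<close>. Extending \<open>g\<close> over the cone is giving a null homotopy of \<open>g \<circ> f\<close>.\<close>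

definition homotopy_cofibration ::
  "'a pointed \<Rightarrow> 'b pointed \<Rightarrow> 'c pointed \<Rightarrow> ('a \<Rightarrow> 'b) \<Rightarrow> ('b \<Rightarrow> 'c) \<Rightarrow> bool" where
  "homotopy_cofibration A B C f g \<longleftrightarrow> pointed_map A B f \<and> pointed_map B C g \<and>
     (\<exists>h. pointed_homotopy_equivalence (mapping_cone A B f) C h \<and>
          (\<forall>b\<in>topspace (fst B). h (mapping_cone_in A f b) = g b))"


section \<open>Higher Whitehead products\<close>

text \<open>A family \<open>i\<^sub>1 < \<dots> < i\<^sub>k\<close> of indices is given as the finite set \<open>I\<close> of its members.\<close>

definition fat_wedge :: "'i set \<Rightarrow> ('i \<Rightarrow> 'a pointed) \<Rightarrow> ('i \<Rightarrow> 'a) pointed" where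
  "fat_wedge I Z = (let P = pointed_product I Z in
     (cg_subspace (fst P) {z. \<exists>i\<in>I. z i = snd (Z i)}, snd P))"

text \<open>The domain \<open>\<Sigma>\<^sup>k\<^sup>-\<^sup>1(X\<^sub>i\<^sub>1 \<and> \<dots> \<and> X\<^sub>i\<^sub>k)\<close>.\<close>

definition whitehead_domain :: "nat set \<Rightarrow> (nat \<Rightarrow> 'a pointed) \<Rightarrow> (complex list \<times> (nat \<Rightarrow> 'a)) pointed" where
  "whitehead_domain I X = iter_susp (card I - 1) (big_smash I X)"

text \<open>The universal higher Whitehead product is specified by its homotopy cofibration, which
  determines it only up to equivalence.\<close>

definition universal_whitehead_product ::
  "nat set \<Rightarrow> (nat \<Rightarrow> 'a pointed) \<Rightarrow>
   (complex list \<times> (nat \<Rightarrow> 'a) \<Rightarrow> nat \<Rightarrow> complex \<times> 'a) \<Rightarrow> bool" where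
  "universal_whitehead_product I X \<phi> \<longleftrightarrow>
     homotopy_cofibration (whitehead_domain I X) (fat_wedge I (\<lambda>i. susp (X i)))
       (pointed_product I (\<lambda>i. susp (X i))) \<phi> id"

definition coord_axis :: "'i set \<Rightarrow> ('i \<Rightarrow> 'a pointed) \<Rightarrow> 'i \<Rightarrow> 'a \<Rightarrow> 'i \<Rightarrow> 'a" where
  "coord_axis I Z i y = (\<lambda>j\<in>I. if j = i then y else snd (Z j))"

definition higher_whitehead_products ::
  "nat set \<Rightarrow> (nat \<Rightarrow> 'a pointed) \<Rightarrow>
   (complex list \<times> (nat \<Rightarrow> 'a) \<Rightarrow> nat \<Rightarrow> complex \<times> 'a) \<Rightarrow>
   'b pointed \<Rightarrow> (nat \<Rightarrow> complex \<times> 'a \<Rightarrow> 'b) \<Rightarrow> (complex list \<times> (nat \<Rightarrow> 'a) \<Rightarrow> 'b) set" where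
  "higher_whitehead_products I X \<phi> Y g =
     {f \<circ> \<phi> | f. pointed_map (fat_wedge I (\<lambda>i. susp (X i))) Y f \<and>
        (\<forall>i\<in>I. \<forall>y\<in>topspace (fst (susp (X i))). f (coord_axis I (\<lambda>i. susp (X i)) i y) = g i y)}"


section \<open>Power couples and polyhedral products\<close>

record 'z power_couple =
  pc_space :: "'z pointed"
  pc_sub :: "'z set"
  pc_pow :: "nat \<Rightarrow> 'z \<Rightarrow> 'z"

definition is_power_couple :: "'z power_couple \<Rightarrow> bool" where
  "is_power_couple P \<longleftrightarrow> pointed_space (pc_space P) \<and>
     pc_sub P \<subseteq> topspace (fst (pc_space P)) \<and> snd (pc_space P) \<in> pc_sub P \<and>
     (\<forall>a\<ge>1. pointed_map (pc_space P) (pc_space P) (pc_pow P a) \<and> pc_pow P a ` pc_sub P \<subseteq> pc_sub P) \<and>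
     (\<forall>x\<in>topspace (fst (pc_space P)). pc_pow P 1 x = x) \<and>
     (\<forall>a\<ge>1. \<forall>b\<ge>1. \<forall>x\<in>topspace (fst (pc_space P)). pc_pow P a (pc_pow P b x) = pc_pow P (a * b) x)"

definition susp_couple :: "'a pointed \<Rightarrow> (complex \<times> 'a) power_couple" where
  "susp_couple X = \<lparr>pc_space = susp X, pc_sub = {snd (susp X)},
     pc_pow = (\<lambda>a (z, x). smash_pt circle X (z ^ a, x))\<rparr>"

lemma pointed_space_susp:
  assumes "pointed_space X"
  shows "pointed_space (susp X)"
  using assms
  unfolding pointed_space_def susp_def smash_def
  apply (auto simp: cg_prod_def intro!: k_space_quotient_map_image[OF quotient_map_quotient_topology])
  apply (rule image_eqI[where x="(1, snd X)"])
  apply (auto simp: smash_pt_def collapse_def circle_def)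
  done

lemma smash_pt_topspace_susp:
  assumes "pointed_space X" "p \<in> topspace (fst (susp X))"
  shows "p \<in> sphere 0 1 \<times> topspace (fst X) \<and> smash_pt circle X p = p"
  using assms by (auto simp: susp_def smash_def cg_prod_def smash_pt_def collapse_def circle_def pointed_space_def)

lemma is_power_couple_susp_couple:
  assumes X: "pointed_space X"
  shows "is_power_couple (susp_couple X)"
proof -
  have base: "snd (susp X) = (1, snd X)" by (simp add: susp_def smash_def circle_def)
  have baset: "(1, snd X) \<in> topspace (fst (susp X))" 
    using pointed_space_susp[OF X] base by (simp add: pointed_space_def)
  let ?P = "\<lambda>a (z, x). smash_pt circle X (z ^ a, x)"
  have cont: "continuous_map (fst (susp X)) (fst (susp X)) (?P a)" for a :: nat
  proof -
    let ?q = "smash_pt circle X" and ?S = "cg_prod (fst circle) (fst X)"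
    have q: "quotient_map ?S (fst (susp X)) ?q"
      by (simp add: susp_def smash_def quotient_map_quotient_topology)
    let ?g = "\<lambda>(z::complex, x::'a). (z ^ a, x)"
    have "continuous_map (fst circle) (fst circle) (\<lambda>z. z^a)"
      by (auto simp: circle_def norm_power intro!: continuous_intros)
    then have "continuous_map (prod_topology (fst circle) (fst X)) (prod_topology (fst circle) (fst X)) ?g"
      by (auto simp: case_prod_unfold continuous_map_pairwise o_def continuous_map_fst_of continuous_map_snd
          intro!: continuous_map_compose[OF continuous_map_fst, unfolded o_def])
    then have "continuous_map ?S ?S ?g"
      by (simp add: cg_prod_def continuous_map_kification)
    then have 1: "continuous_map ?S (fst (susp X)) (?q \<circ> ?g)"
      using continuous_map_compose q quotient_imp_continuous_map by blast
    have "?P a (?q p) = (?q \<circ> ?g) p" for p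
      by (auto simp: smash_pt_def collapse_def circle_def split: prod.splits)
    then have "?P a \<circ> ?q = ?q \<circ> ?g" by (auto simp: fun_eq_iff)
    with 1 q show ?thesis by (metis continuous_compose_quotient_map)
  qed
  have "?P a (1, snd X) = (1, snd X)" for a
    by (simp add: smash_pt_def collapse_def circle_def)
  moreover have "?P a (?P b p) = ?P (a*b) p" for a b p
    using power_mult[of "fst p" b a]
    by (auto simp: smash_pt_def collapse_def circle_def mult.commute split: prod.splits)
  ultimately show ?thesis
    using cont baset pointed_space_susp[OF X] base smash_pt_topspace_susp[OF X]
    unfolding is_power_couple_def susp_couple_def pointed_map_def
    by (auto)
qed

definition pc_product :: "nat \<Rightarrow> (nat \<Rightarrow> 'z power_couple) \<Rightarrow> (nat \<Rightarrow> 'z) pointed" where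
  "pc_product m Z = pointed_product {1..m} (\<lambda>i. pc_space (Z i))"

definition poly_points :: "nat \<Rightarrow> (nat \<Rightarrow> 'z power_couple) \<Rightarrow> nat set set \<Rightarrow> (nat \<Rightarrow> 'z) set" where
  "poly_points m Z K = {z \<in> topspace (fst (pc_product m Z)).
     \<exists>\<sigma>\<in>K. \<forall>i\<in>{1..m} - \<sigma>. z i \<in> pc_sub (Z i)}"

text \<open>\<open>(Z,A)\<^sup>K\<close>; the space \<open>(Z,A)\<^sup>\<sigma>\<close> is the case \<open>K = {\<sigma>}\<close>.\<close>

definition poly_product :: "nat \<Rightarrow> (nat \<Rightarrow> 'z power_couple) \<Rightarrow> nat set set \<Rightarrow> (nat \<Rightarrow> 'z) topology" where
  "poly_product m Z K = cg_subspace (fst (pc_product m Z)) (poly_points m Z K)"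

definition bd :: "nat set \<Rightarrow> nat set set" where
  "bd \<sigma> = {\<tau>. \<tau> \<subset> \<sigma>}"

definition power_sequence :: "nat \<Rightarrow> (nat set \<Rightarrow> nat \<Rightarrow> nat) \<Rightarrow> bool" where
  "power_sequence m c \<longleftrightarrow>
     (\<forall>\<sigma>. \<sigma> \<subseteq> {1..m} \<longrightarrow> (\<forall>i\<in>{1..m}. c \<sigma> i \<ge> 1) \<and> (\<forall>i\<in>{1..m} - \<sigma>. c \<sigma> i = 1)) \<and>
     (\<forall>\<sigma> \<tau>. \<sigma> \<subseteq> {1..m} \<longrightarrow> \<tau> \<subseteq> \<sigma> \<longrightarrow> (\<forall>i\<in>{1..m}. c \<tau> i dvd c \<sigma> i))"

definition power_map ::
  "nat \<Rightarrow> (nat \<Rightarrow> 'z power_couple) \<Rightarrow> (nat set \<Rightarrow> nat \<Rightarrow> nat) \<Rightarrow> nat set \<Rightarrow> nat set \<Rightarrow>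
   (nat \<Rightarrow> 'z) \<Rightarrow> nat \<Rightarrow> 'z" where
  "power_map m Z c \<sigma> \<tau> z = (\<lambda>i\<in>{1..m}. pc_pow (Z i) (c \<sigma> i div c \<tau> i) (z i))"


section \<open>Weighted polyhedral products\<close>

text \<open>One type holding the points of all \<open>(Z,A)\<^bsup>\<sigma>,c\<^esup>\<close>: the pushout defining \<open>(Z,A)\<^bsup>\<sigma>,c\<^esup>\<close> consists
  of points of \<open>(Z,A)\<^sup>\<sigma>\<close> and of \<open>(Z,A)\<^bsup>\<partial>\<sigma>,c\<^esup>\<close>, and the colimit \<open>(Z,A)\<^bsup>\<partial>\<sigma>,c\<^esup>\<close> consists of pairs of a
  face \<open>\<tau>\<close> and a point of \<open>(Z,A)\<^bsup>\<tau>,c\<^esup>\<close>.\<close>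

datatype 'p wpoint = WPoint "'p + nat set \<times> 'p wpoint"

text \<open>For a fixed \<open>\<sigma>\<close>: the space \<open>(Z,A)\<^bsup>\<sigma>,c\<^esup>\<close>, the map \<open>\<eta>(\<sigma>)\<close>, and for each \<open>\<tau> \<subset> \<sigma>\<close> the structure
  map \<open>(Z,A)\<^bsup>\<tau>,c\<^esup> \<rightarrow> (Z,A)\<^bsup>\<sigma>,c\<^esup>\<close>.\<close>

record 'p wdata =
  wd_space :: "'p wpoint topology"
  wd_eta :: "'p \<Rightarrow> 'p wpoint"
  wd_trans :: "nat set \<Rightarrow> 'p wpoint \<Rightarrow> 'p wpoint"

text \<open>The constructions at \<open>\<partial>\<sigma>\<close>, from the data \<open>D \<tau>\<close> at the proper faces \<open>\<tau>\<close> of \<open>\<sigma>\<close>.\<close>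

definition wtrans :: "(nat set \<Rightarrow> 'p wdata) \<Rightarrow> nat set \<Rightarrow> nat set \<Rightarrow> 'p wpoint \<Rightarrow> 'p wpoint" where
  "wtrans D \<tau> \<tau>' = (if \<tau> = \<tau>' then id else wd_trans (D \<tau>') \<tau>)"

definition bd_space :: "(nat set \<Rightarrow> 'p wdata) \<Rightarrow> nat set \<Rightarrow> (nat set \<times> 'p wpoint) topology" where
  "bd_space D \<sigma> = colim (bd \<sigma>) (\<lambda>\<tau>. wd_space (D \<tau>)) (wtrans D)"

definition bd_in :: "(nat set \<Rightarrow> 'p wdata) \<Rightarrow> nat set \<Rightarrow> nat set \<Rightarrow> 'p wpoint \<Rightarrow> nat set \<times> 'p wpoint" where
  "bd_in D \<sigma> \<tau> w = glue (colim_rel (bd \<sigma>) (\<lambda>\<tau>. wd_space (D \<tau>)) (wtrans D)) (\<tau>, w)"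

definition bd_eta ::
  "nat \<Rightarrow> (nat \<Rightarrow> 'z power_couple) \<Rightarrow> (nat set \<Rightarrow> nat \<Rightarrow> nat) \<Rightarrow> (nat set \<Rightarrow> (nat \<Rightarrow> 'z) wdata) \<Rightarrow>
   nat set \<Rightarrow> (nat \<Rightarrow> 'z) \<Rightarrow> nat set \<times> (nat \<Rightarrow> 'z) wpoint" where
  "bd_eta m Z c D \<sigma> z = (THE v. \<forall>\<tau>\<in>bd \<sigma>. z \<in> poly_points m Z {\<tau>} \<longrightarrow>
     v = bd_in D \<sigma> \<tau> (wd_eta (D \<tau>) (power_map m Z c \<sigma> \<tau> z)))"

definition wpp_step ::
  "nat \<Rightarrow> (nat \<Rightarrow> 'z power_couple) \<Rightarrow> (nat set \<Rightarrow> nat \<Rightarrow> nat) \<Rightarrow> nat set \<Rightarrow>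
   (nat set \<Rightarrow> (nat \<Rightarrow> 'z) wdata) \<Rightarrow> (nat \<Rightarrow> 'z) wdata" where
  "wpp_step m Z c \<sigma> D =
     (if \<sigma> = {} then
        \<lparr>wd_space = quotient_topology (poly_product m Z {{}}) (WPoint \<circ> Inl),
         wd_eta = WPoint \<circ> Inl,
         wd_trans = (\<lambda>_. id)\<rparr>
      else let A = poly_points m Z (bd \<sigma>); f = bd_eta m Z c D \<sigma>; q = glue (pushout_rel A id f) in
        \<lparr>wd_space = quotient_topology (pushout (poly_product m Z {\<sigma>}) A id f (bd_space D \<sigma>)) WPoint,
         wd_eta = WPoint \<circ> q \<circ> Inl,
         wd_trans = (\<lambda>\<tau>. WPoint \<circ> q \<circ> Inr \<circ> bd_in D \<sigma> \<tau>)\<rparr>)"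

function wpp ::
  "nat \<Rightarrow> (nat \<Rightarrow> 'z power_couple) \<Rightarrow> (nat set \<Rightarrow> nat \<Rightarrow> nat) \<Rightarrow> nat set \<Rightarrow> (nat \<Rightarrow> 'z) wdata" where
  "wpp m Z c \<sigma> =
     wpp_step m Z c \<sigma> (\<lambda>\<tau>. if finite \<sigma> \<and> \<tau> \<subset> \<sigma> then wpp m Z c \<tau> else undefined)"
  by auto
termination
  by (relation "Wellfounded.measure (\<lambda>(m, Z, c, \<sigma>). card \<sigma>)") (auto intro: psubset_card_mono)

declare wpp.simps [simp del]

text \<open>\<open>(Z,A)\<^bsup>\<partial>\<sigma>,c\<^esup>\<close> as a pointed space, and the map \<open>\<eta>(\<partial>\<sigma>)\<close>.\<close>

definition wpp_bd :: "nat \<Rightarrow> (nat \<Rightarrow> 'z power_couple) \<Rightarrow> (nat set \<Rightarrow> nat \<Rightarrow> nat) \<Rightarrow> nat set \<Rightarrow>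
   (nat set \<times> (nat \<Rightarrow> 'z) wpoint) pointed" where
  "wpp_bd m Z c \<sigma> =
     (bd_space (wpp m Z c) \<sigma>,
      bd_in (wpp m Z c) \<sigma> {} (wd_eta (wpp m Z c {}) (snd (pc_product m Z))))"

definition eta_bd :: "nat \<Rightarrow> (nat \<Rightarrow> 'z power_couple) \<Rightarrow> (nat set \<Rightarrow> nat \<Rightarrow> nat) \<Rightarrow> nat set \<Rightarrow>
   (nat \<Rightarrow> 'z) \<Rightarrow> nat set \<times> (nat \<Rightarrow> 'z) wpoint" where
  "eta_bd m Z c \<sigma> = bd_eta m Z c (wpp m Z c) \<sigma>"

text \<open>For \<open>A\<^sub>i = *\<close>, the space \<open>Z\<^sub>i\<close> is identified with \<open>(Z,A)\<^bsup>{i}\<^esup>\<close> as the \<open>i\<close>-th coordinate axis,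
  and then with \<open>(Z,A)\<^bsup>{i},c\<^esup>\<close> by \<open>\<eta>({i})\<close>.\<close>

definition iota :: "nat \<Rightarrow> (nat \<Rightarrow> 'z power_couple) \<Rightarrow> (nat set \<Rightarrow> nat \<Rightarrow> nat) \<Rightarrow> nat set \<Rightarrow> nat \<Rightarrow>
   'z \<Rightarrow> nat set \<times> (nat \<Rightarrow> 'z) wpoint" where
  "iota m Z c \<sigma> i y =
     bd_in (wpp m Z c) \<sigma> {i} (wd_eta (wpp m Z c {i}) (coord_axis {1..m} (\<lambda>j. pc_space (Z j)) i y))"

text \<open>The identification of the fat wedge of the \<open>Z\<^sub>i\<close>, \<open>i \<in> \<sigma>\<close>, with \<open>(Z,*)\<^bsup>\<partial>\<sigma>\<^esup>\<close>.\<close>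

definition fat_wedge_incl :: "nat \<Rightarrow> (nat \<Rightarrow> 'z power_couple) \<Rightarrow> nat set \<Rightarrow> (nat \<Rightarrow> 'z) \<Rightarrow> nat \<Rightarrow> 'z" where
  "fat_wedge_incl m Z \<sigma> z = (\<lambda>i\<in>{1..m}. if i \<in> \<sigma> then z i else snd (pc_space (Z i)))"

end

theory Submission
  imports Defs
begin

text \<open>
  Identify the fat wedge of the \<open>\<Sigma>X\<^sub>i\<close>, \<open>i \<in> \<sigma>\<close>, with \<open>(\<Sigma>X,*)\<^bsup>\<partial>\<sigma>\<^esup>\<close>, and let \<open>f\<close> be \<open>\<eta>(\<partial>\<sigma>)\<close> seen
  as a map on the fat wedge. Then \<open>\<eta>(\<partial>\<sigma>) \<circ> \<phi>\<close> is by definition \<open>f \<circ> \<phi>\<close>, so it is a higher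
  Whitehead product of whatever maps \<open>f\<close> restricts to on the coordinate axes. On the face \<open>{i}\<close> of
  \<open>\<partial>\<sigma>\<close>, the map \<open>\<eta>(\<partial>\<sigma>)\<close> is the power map \<open>c\<^bsup>\<sigma>/{i}\<^esup>\<close> followed by \<open>\<iota>\<^sub>i\<close>. Its exponent at \<open>i\<close> is
  \<open>c \<sigma> i / c {i} i = c \<sigma> i\<close>, and the other power operations only see the basepoint, which they fix.
  So \<open>f\<close> restricts to \<open>c \<sigma> i \<cdot> \<iota>\<^sub>i\<close> on the \<open>i\<close>-th axis.

  Two points need work. First, \<open>\<eta>(\<partial>\<sigma>)\<close> must be well defined: the prescriptions on the faces of
  \<open>\<partial>\<sigma>\<close> have to agree where faces meet. This is \<open>eta_bd_face\<close>, by induction on \<open>\<sigma>\<close>.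
  If a point of \<open>(Z,A)\<^bsup>\<tau>\<^esup>\<close> already lies in \<open>(Z,A)\<^bsup>\<tau>'\<^esup>\<close> for a smaller \<open>\<tau>'\<close>, then its
  image under \<open>\<eta>(\<tau>)\<close> is computed, by the pushout, from \<open>\<eta>(\<partial>\<tau>)\<close>, thus from \<open>\<eta>(\<tau>')\<close> by the
  induction hypothesis; the exponents \<open>c \<sigma> / c \<tau>\<close> and \<open>c \<tau> / c \<tau>'\<close> multiply to \<open>c \<sigma> / c \<tau>'\<close>, and
  the colimit identifies the two results.

  Second, \<open>f\<close> must be continuous for the topology of the fat wedge as a subspace of the product.
  Each restriction to a face is continuous, but the usual pasting lemma needs closed faces, and no
  separation axiom makes the basepoints closed. Pasting still holds, as \<open>continuous_map_fat_wedge\<close>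
  shows: a point in the closure of the basepoint has the basepoint in each of its neighbourhoods, so
  that for open sets it behaves like the basepoint itself.
\<close>

section \<open>Pasting on the fat wedge\<close>

text \<open>Kification keeps the specialization order: two points form a compact set, and on compact
  sets the topology is unchanged.\<close>

lemma openin_kification_specialization:
  assumes U: "openin (kification X) U" "x \<in> U" and x: "x \<in> X closure_of {y}" and y: "y \<in> topspace X"
  shows "y \<in> U"
proof -
  have "x \<in> topspace X"
    using x by (simp add: in_closure_of)
  with y have "compactin X {x, y}"
    by (intro finite_imp_compactin) auto
  with U have "openin (subtopology X {x, y}) ({x, y} \<inter> U)"
    by (auto simp: openin_kification simp del: Int_insert_left)
  then obtain W where W: "openin X W" "{x, y} \<inter> U = W \<inter> {x, y}"
    by (auto simp: openin_subtopology)
  with U have "x \<in> W"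
    by auto
  with x W have "y \<in> W"
    by (auto simp: in_closure_of)
  with W show ?thesis
    by auto
qed

definition face_retraction :: "'i set \<Rightarrow> ('i \<Rightarrow> 'a pointed) \<Rightarrow> 'i set \<Rightarrow> ('i \<Rightarrow> 'a) \<Rightarrow> 'i \<Rightarrow> 'a" where
  "face_retraction I Z \<tau> z = (\<lambda>i\<in>I. if i \<in> \<tau> then z i else snd (Z i))"

lemma topspace_cg_product: "topspace (cg_product I X) = (\<Pi>\<^sub>E i\<in>I. topspace (X i))"
  by (simp add: cg_product_def)

lemma continuous_map_cg_product_projection:
  "i \<in> I \<Longrightarrow> continuous_map (cg_product I X) (X i) (\<lambda>x. x i)"
  by (simp add: cg_product_def continuous_map_from_kification continuous_map_product_projection)

text \<open>
  Let \<open>V\<close> be open in \<open>Y\<close>, with preimage \<open>U\<close> in the fat wedge. For a proper subset \<open>T\<close> of \<open>I\<close>,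
  consider the open set of points \<open>z\<close> of the product with \<open>z i\<close> outside the closure of the basepoint
  for \<open>i \<in> T\<close>, and whose retractions to all proper faces \<open>\<tau> \<supseteq> T\<close> lie in \<open>U\<close>. The union of these sets
  over all \<open>T\<close> meets the fat wedge exactly in \<open>U\<close>. A point of the fat wedge lying in the set for \<open>T\<close>
  is supported on a proper face containing \<open>T\<close>, and the retraction to this face fixes it, so it is
  in \<open>U\<close>. Conversely, given a point \<open>z\<close> of \<open>U\<close>, let \<open>T\<close> consist of the \<open>i\<close> with \<open>z i\<close> outside the
  closure of the basepoint. Each neighbourhood of \<open>z\<close> then contains the retractions of \<open>z\<close> to the
  faces \<open>\<tau> \<supseteq> T\<close>, so these remain in \<open>U\<close>.
\<close>

proposition continuous_map_fat_wedge:
  assumes I: "finite I" and Z: "\<And>i. i \<in> I \<Longrightarrow> pointed_space (Z i)"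
    and f: "\<And>\<tau>. \<tau> \<subset> I \<Longrightarrow>
      continuous_map (cg_product I (\<lambda>i. fst (Z i))) Y (f \<circ> face_retraction I Z \<tau>)"
  shows "continuous_map (fst (fat_wedge I Z)) Y f"
proof -
  let ?P = "cg_product I (\<lambda>i. fst (Z i))" and ?r = "face_retraction I Z"
  define F where "F = {z. \<exists>i\<in>I. z i = snd (Z i)}"
  define supp where "supp z = {i\<in>I. z i \<noteq> snd (Z i)}" for z
  define cl where "cl i = fst (Z i) closure_of {snd (Z i)}" for i
  have supp_proper: "supp z \<subset> I" if "z \<in> F" for z
    using that by (auto simp: F_def supp_def)
  have fixed: "?r \<tau> z = z" if "z \<in> topspace ?P" "supp z \<subseteq> \<tau>" for z \<tau>
    using that by (auto simp: topspace_cg_product face_retraction_def supp_def fun_eq_iff PiE_def extensional_def)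
  have r_in: "?r \<tau> z \<in> topspace ?P" if "z \<in> topspace ?P" for z \<tau>
    using that Z by (auto simp: topspace_cg_product face_retraction_def pointed_space_def)
  have base_cl: "snd (Z i) \<in> cl i" if "i \<in> I" for i
    using Z[OF that] by (auto simp: cl_def in_closure_of pointed_space_def)
  have "openin (subtopology ?P F) {z \<in> topspace (subtopology ?P F). f z \<in> V}" if V: "openin Y V" for V
  proof -
    define R where "R \<tau> = {z \<in> topspace ?P. f (?r \<tau> z) \<in> V}" for \<tau>
    define G where "G T = {z \<in> topspace ?P. \<forall>i\<in>T. z i \<notin> cl i}" for T
    \<comment> \<open>Indexing by proper subsets \<open>T\<close> makes the intersection nonempty, as it contains the term
      for \<open>\<tau> = T\<close>; this loses nothing because points of the fat wedge have proper support.\<close>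
    define W where "W = (\<Union>T\<in>{T. T \<subset> I}. G T \<inter> (\<Inter>\<tau>\<in>{\<tau>. T \<subseteq> \<tau> \<and> \<tau> \<subset> I}. R \<tau>))"
    have W_iff: "z \<in> W \<longleftrightarrow> (\<exists>T\<subset>I. z \<in> G T \<and> (\<forall>\<tau>. T \<subseteq> \<tau> \<and> \<tau> \<subset> I \<longrightarrow> z \<in> R \<tau>))" for z
      by (simp add: W_def Bex_def)
    have R_open: "openin ?P (R \<tau>)" if "\<tau> \<subset> I" for \<tau>
      using f[OF that] V unfolding R_def continuous_map by (auto simp: o_def)
    have G_open: "openin ?P (G T)" if "T \<subset> I" for T
    proof -
      have "openin ?P {z \<in> topspace ?P. z i \<in> topspace (fst (Z i)) - cl i}" if "i \<in> I" for i
        by (rule openin_continuous_map_preimage[OF continuous_map_cg_product_projection[OF that]])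
           (simp add: cl_def openin_diff)
      moreover have "G T = (\<Inter>i\<in>T. {z \<in> topspace ?P. z i \<in> topspace (fst (Z i)) - cl i}) \<inter> topspace ?P"
        using \<open>T \<subset> I\<close> by (auto simp: G_def topspace_cg_product PiE_iff extensional_def)
      ultimately show ?thesis
        using finite_subset[of T I] I \<open>T \<subset> I\<close> by (auto intro!: openin_INT)
    qed
    have W_open: "openin ?P W"
      unfolding W_def
    proof (rule openin_Union)
      fix S assume "S \<in> (\<lambda>T. G T \<inter> (\<Inter>\<tau>\<in>{\<tau>. T \<subseteq> \<tau> \<and> \<tau> \<subset> I}. R \<tau>)) ` {T. T \<subset> I}"
      then obtain T where T: "T \<subset> I" and S: "S = G T \<inter> (\<Inter>\<tau>\<in>{\<tau>. T \<subseteq> \<tau> \<and> \<tau> \<subset> I}. R \<tau>)"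
        by blast
      have "finite {\<tau>. T \<subseteq> \<tau> \<and> \<tau> \<subset> I}"
        by (rule finite_subset[of _ "Pow I"]) (use I in auto)
      moreover have "{\<tau>. T \<subseteq> \<tau> \<and> \<tau> \<subset> I} \<noteq> {}"
        using T by auto
      ultimately show "openin ?P S"
        unfolding S using G_open[OF T] R_open by (intro openin_Int openin_INT2) auto
    qed
    have "z \<in> W" if z: "z \<in> topspace ?P" "z \<in> F" "f z \<in> V" for z
    proof -
      define T where "T = {i\<in>I. z i \<notin> cl i}"
      have T_supp: "T \<subseteq> supp z"
        using base_cl by (auto simp: T_def supp_def)
      have T: "T \<subset> I"
        using T_supp supp_proper[OF z(2)] by auto
      have "z \<in> R \<tau>" if \<tau>: "T \<subseteq> \<tau>" "\<tau> \<subset> I" for \<tau>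
      proof -
        \<comment> \<open>Coordinates in \<open>\<tau>\<close> are kept; the others lie in the closure of the basepoint that
          replaces them.\<close>
        have closure: "z \<in> product_topology (\<lambda>i. fst (Z i)) I closure_of {?r \<tau> z}"
        proof -
          have "z i \<in> fst (Z i) closure_of {?r \<tau> z i}" if "i \<in> I" for i
          proof (cases "i \<in> \<tau>")
            case True
            then show ?thesis
              using z(1) that by (auto simp: face_retraction_def in_closure_of topspace_cg_product)
          next
            case False
            then have "z i \<in> cl i"
              using \<tau> that by (auto simp: T_def)
            then show ?thesis
              using False that by (simp add: face_retraction_def cl_def)
          qed
          then have "z \<in> (\<Pi>\<^sub>E i\<in>I. fst (Z i) closure_of {?r \<tau> z i})"
            using z(1) by (auto simp: topspace_cg_product PiE_iff)
          also have "\<dots> = product_topology (\<lambda>i. fst (Z i)) I closure_of (\<Pi>\<^sub>E i\<in>I. {?r \<tau> z i})"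
            by (simp add: closure_of_product_topology)
          also have "(\<Pi>\<^sub>E i\<in>I. {?r \<tau> z i}) = {?r \<tau> z}"
            by (rule PiE_singleton) (simp add: face_retraction_def extensional_def)
          finally show ?thesis .
        qed
        have "z \<in> R (supp z)"
          using z by (simp add: R_def fixed)
        moreover have "?r \<tau> z \<in> topspace (product_topology (\<lambda>i. fst (Z i)) I)"
          using r_in[OF z(1), of \<tau>] by (simp add: cg_product_def)
        ultimately have "?r \<tau> z \<in> R (supp z)"
          by (rule openin_kification_specialization[OF R_open[OF supp_proper[OF z(2)], unfolded cg_product_def] _ closure])
        moreover have "?r (supp z) (?r \<tau> z) = ?r \<tau> z"
          using r_in[OF z(1), of \<tau>] by (rule fixed) (auto simp: supp_def face_retraction_def)
        ultimately show ?thesis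
          using z(1) by (simp add: R_def)
      qed
      moreover have "z \<in> G T"
        using z(1) by (simp add: G_def T_def)
      ultimately show ?thesis
        using T by (simp only: W_iff) iprover
    qed
    moreover have "f z \<in> V" if z: "z \<in> W" "z \<in> F" for z
    proof -
      obtain T where T: "z \<in> G T" "T \<subset> I" "\<And>\<tau>. T \<subseteq> \<tau> \<Longrightarrow> \<tau> \<subset> I \<Longrightarrow> z \<in> R \<tau>"
        using z(1) by (simp only: W_iff) iprover
      have "T \<subseteq> supp z"
      proof
        fix i assume "i \<in> T"
        then have "i \<in> I" "z i \<notin> cl i"
          using T(1,2) by (auto simp: G_def)
        then show "i \<in> supp z"
          using base_cl[of i] by (auto simp: supp_def)
      qed
      then have "z \<in> R (supp z)"
        by (rule T(3)[OF _ supp_proper[OF z(2)]])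
      moreover from this have "?r (supp z) z = z"
        by (simp add: R_def fixed)
      ultimately show ?thesis
        by (simp add: R_def)
    qed
    ultimately have "{z \<in> topspace (subtopology ?P F). f z \<in> V} = W \<inter> F"
      using openin_subset[OF W_open] by auto
    with W_open show ?thesis
      by (auto simp: openin_subtopology)
  qed
  moreover have "f z \<in> topspace Y" if "z \<in> topspace (subtopology ?P F)" for z
  proof -
    have z: "z \<in> topspace ?P" "z \<in> F"
      using that by auto
    have "(f \<circ> ?r (supp z)) z \<in> topspace Y"
      using f[OF supp_proper[OF z(2)]] z(1) unfolding continuous_map_def by blast
    then show ?thesis
      using z(1) by (simp add: fixed)
  qed
  ultimately have "continuous_map (subtopology ?P F) Y f"
    by (auto simp: continuous_map)
  then show ?thesis
    by (simp add: fat_wedge_def pointed_product_def Let_def cg_subspace_def F_def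
        continuous_map_from_kification)
qed


section \<open>Structure maps of pushouts and colimits\<close>

lemma continuous_map_quotient_topology: "continuous_map X (quotient_topology X q) q"
  by (simp add: quotient_imp_continuous_map quotient_map_quotient_topology)

lemma topspace_coprod_topology: "topspace (coprod_topology X Y) = Inl ` topspace X \<union> Inr ` topspace Y"
proof
  have "openin X (Inl -` topspace (coprod_topology X Y))" "openin Y (Inr -` topspace (coprod_topology X Y))"
    using openin_topspace[of "coprod_topology X Y"] unfolding openin_coprod_topology by auto
  then have sub: "Inl -` topspace (coprod_topology X Y) \<subseteq> topspace X"
    "Inr -` topspace (coprod_topology X Y) \<subseteq> topspace Y"
    by (auto dest: openin_subset)
  show "topspace (coprod_topology X Y) \<subseteq> Inl ` topspace X \<union> Inr ` topspace Y"
  proof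
    fix p assume "p \<in> topspace (coprod_topology X Y)"
    then show "p \<in> Inl ` topspace X \<union> Inr ` topspace Y"
      using sub by (cases p) auto
  qed
  have "Inl -` (Inl ` topspace X \<union> Inr ` topspace Y) = topspace X"
    "Inr -` (Inl ` topspace X \<union> Inr ` topspace Y) = topspace Y"
    by auto
  then show "Inl ` topspace X \<union> Inr ` topspace Y \<subseteq> topspace (coprod_topology X Y)"
    by (intro openin_subset) (simp add: openin_coprod_topology)
qed

lemma continuous_map_Inl: "continuous_map X (coprod_topology X Y) Inl"
  unfolding continuous_map
proof (intro conjI allI impI)
  fix U assume "openin (coprod_topology X Y) U"
  then have "openin X (Inl -` U)"
    by (simp add: openin_coprod_topology)
  moreover have "{x \<in> topspace X. Inl x \<in> U} = topspace X \<inter> Inl -` U"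
    by auto
  ultimately show "openin X {x \<in> topspace X. Inl x \<in> U}"
    by auto
qed (auto simp: topspace_coprod_topology)

lemma continuous_map_pushout_Inl:
  "continuous_map X (pushout X A i f Y) (glue (pushout_rel A i f) \<circ> Inl)"
  unfolding pushout_def
  by (rule continuous_map_compose[OF continuous_map_Inl continuous_map_quotient_topology])

lemma pushout_glue: "a \<in> A \<Longrightarrow> glue (pushout_rel A i f) (Inl (i a)) = glue (pushout_rel A i f) (Inr (f a))"
  unfolding glue_eq_iff by (rule r_into_rtrancl) (auto simp: pushout_rel_def)

lemma continuous_map_colim_in:
  "i \<in> I \<Longrightarrow> continuous_map (D i) (colim I D d) (\<lambda>x. glue (colim_rel I D d) (i, x))"
  unfolding colim_def
  using continuous_map_compose[OF continuous_map_component_injection continuous_map_quotient_topology]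
  by (fastforce simp: o_def)

lemma colim_glue:
  "i \<in> I \<Longrightarrow> j \<in> I \<Longrightarrow> i \<le> j \<Longrightarrow> x \<in> topspace (D i) \<Longrightarrow>
    glue (colim_rel I D d) (i, x) = glue (colim_rel I D d) (j, d i j x)"
  unfolding glue_eq_iff by (rule r_into_rtrancl) (auto simp: colim_rel_def)


section \<open>Weighted polyhedral products\<close>

lemma continuous_map_bd_in:
  "\<tau> \<subset> \<sigma> \<Longrightarrow> continuous_map (wd_space (D \<tau>)) (bd_space D \<sigma>) (bd_in D \<sigma> \<tau>)"
  unfolding bd_space_def bd_in_def
  using continuous_map_colim_in[of \<tau> "bd \<sigma>" "\<lambda>\<tau>. wd_space (D \<tau>)" "wtrans D"] by (simp add: bd_def)

lemma bd_in_wd_trans: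
  assumes "\<rho> \<subset> \<tau>" "\<tau> \<subset> \<sigma>" "w \<in> topspace (wd_space (D \<rho>))"
  shows "bd_in D \<sigma> \<tau> (wd_trans (D \<tau>) \<rho> w) = bd_in D \<sigma> \<rho> w"
  using colim_glue[of \<rho> "bd \<sigma>" \<tau> w "\<lambda>\<tau>. wd_space (D \<tau>)" "wtrans D"] assms
  by (auto simp: bd_in_def bd_def wtrans_def)

text \<open>The recursion for the weighted product at \<open>\<sigma>\<close> hides all but the proper faces of \<open>\<sigma>\<close>; these
  congruences let its unfolding mention the unrestricted function \<^const>\<open>wpp\<close>.\<close>

lemma bd_cong:
  assumes "\<And>\<tau>. \<tau> \<subset> \<sigma> \<Longrightarrow> D \<tau> = E \<tau>"
  shows bd_in_cong: "bd_in D \<sigma> = bd_in E \<sigma>"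
    and bd_space_cong: "bd_space D \<sigma> = bd_space E \<sigma>"
    and bd_eta_cong: "bd_eta m Z c D \<sigma> = bd_eta m Z c E \<sigma>"
proof -
  have D: "D \<tau> = E \<tau>" if "\<tau> \<in> bd \<sigma>" for \<tau>
    using assms that by (simp add: bd_def)
  have rel: "colim_rel (bd \<sigma>) (\<lambda>\<tau>. wd_space (D \<tau>)) (wtrans D) =
             colim_rel (bd \<sigma>) (\<lambda>\<tau>. wd_space (E \<tau>)) (wtrans E)"
    unfolding colim_rel_def wtrans_def using D by (auto; metis)
  then show bd_in: "bd_in D \<sigma> = bd_in E \<sigma>"
    by (simp add: bd_in_def fun_eq_iff)
  have "sum_topology (\<lambda>\<tau>. wd_space (D \<tau>)) (bd \<sigma>) = sum_topology (\<lambda>\<tau>. wd_space (E \<tau>)) (bd \<sigma>)"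
    using D by (simp add: topology_eq openin_sum_topology cong: Sigma_cong)
  with rel show "bd_space D \<sigma> = bd_space E \<sigma>"
    by (simp add: bd_space_def colim_def)
  show "bd_eta m Z c D \<sigma> = bd_eta m Z c E \<sigma>"
    using D by (simp add: bd_eta_def fun_eq_iff bd_in cong: ball_cong)
qed

lemma wpp_empty:
  "wd_space (wpp m Z c {}) = quotient_topology (poly_product m Z {{}}) (WPoint \<circ> Inl)"
  "wd_eta (wpp m Z c {}) = WPoint \<circ> Inl"
  by (simp_all add: wpp.simps[of m Z c "{}"] wpp_step_def)

lemma wpp_nonempty:
  fixes m Z c \<sigma>
  defines "q \<equiv> glue (pushout_rel (poly_points m Z (bd \<sigma>)) id (eta_bd m Z c \<sigma>))"
  assumes "finite \<sigma>" "\<sigma> \<noteq> {}"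
  shows "wd_space (wpp m Z c \<sigma>) =
      quotient_topology (pushout (poly_product m Z {\<sigma>}) (poly_points m Z (bd \<sigma>)) id
        (eta_bd m Z c \<sigma>) (bd_space (wpp m Z c) \<sigma>)) WPoint"
    and "wd_eta (wpp m Z c \<sigma>) = WPoint \<circ> q \<circ> Inl"
    and "wd_trans (wpp m Z c \<sigma>) \<tau> = WPoint \<circ> q \<circ> Inr \<circ> bd_in (wpp m Z c) \<sigma> \<tau>"
proof -
  let ?D = "\<lambda>\<tau>. if finite \<sigma> \<and> \<tau> \<subset> \<sigma> then wpp m Z c \<tau> else undefined"
  have D: "?D \<tau> = wpp m Z c \<tau>" if "\<tau> \<subset> \<sigma>" for \<tau>
    using that assms by simp
  note cong = bd_in_cong[of \<sigma> ?D "wpp m Z c", OF D] bd_space_cong[of \<sigma> ?D "wpp m Z c", OF D]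
    bd_eta_cong[of \<sigma> ?D "wpp m Z c" m Z c, OF D]
  show "wd_space (wpp m Z c \<sigma>) =
      quotient_topology (pushout (poly_product m Z {\<sigma>}) (poly_points m Z (bd \<sigma>)) id
        (eta_bd m Z c \<sigma>) (bd_space (wpp m Z c) \<sigma>)) WPoint"
    "wd_eta (wpp m Z c \<sigma>) = WPoint \<circ> q \<circ> Inl"
    "wd_trans (wpp m Z c \<sigma>) \<tau> = WPoint \<circ> q \<circ> Inr \<circ> bd_in (wpp m Z c) \<sigma> \<tau>"
    using assms(3)
    by (simp_all add: wpp.simps[of m Z c \<sigma>] wpp_step_def Let_def q_def eta_bd_def
        cong[unfolded if_bool_eq_conj])
qed

lemma topspace_poly_product: "topspace (poly_product m Z K) = poly_points m Z K"
  by (auto simp: poly_product_def cg_subspace_def poly_points_def)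

text \<open>As a structure map of a pushout, \<open>\<eta>(\<sigma>)\<close> is continuous whether or not \<open>\<eta>(\<partial>\<sigma>)\<close> is, so this
  is no induction over faces.\<close>

lemma continuous_map_wd_eta:
  assumes "finite \<sigma>"
  shows "continuous_map (poly_product m Z {\<sigma>}) (wd_space (wpp m Z c \<sigma>)) (wd_eta (wpp m Z c \<sigma>))"
proof (cases "\<sigma> = {}")
  case True
  then show ?thesis
    by (simp add: wpp_empty continuous_map_quotient_topology)
next
  case False
  show ?thesis
    unfolding wpp_nonempty[OF assms False] o_assoc[symmetric]
    by (rule continuous_map_compose[OF continuous_map_pushout_Inl continuous_map_quotient_topology])
qed

text \<open>The gluing in the pushout: on boundary points, \<open>\<eta>(\<sigma>)\<close> is read off from \<open>\<eta>(\<partial>\<sigma>)\<close>.\<close>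

lemma wd_eta_boundary:
  assumes "finite \<sigma>" "\<tau> \<subset> \<sigma>" "z \<in> poly_points m Z (bd \<sigma>)"
    and "eta_bd m Z c \<sigma> z = bd_in (wpp m Z c) \<sigma> \<tau> w"
  shows "wd_eta (wpp m Z c \<sigma>) z = wd_trans (wpp m Z c \<sigma>) \<tau> w"
proof -
  have "\<sigma> \<noteq> {}"
    using assms by auto
  then show ?thesis
    using pushout_glue[OF assms(3), of id "eta_bd m Z c \<sigma>"] assms by (simp add: wpp_nonempty)
qed

locale weighted_couples =
  fixes m :: nat and Z :: "nat \<Rightarrow> 'z power_couple" and c :: "nat set \<Rightarrow> nat \<Rightarrow> nat"
  assumes couple: "\<And>i. i \<in> {1..m} \<Longrightarrow> is_power_couple (Z i)"
    and sequence: "power_sequence m c"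
begin

abbreviation "\<rho> \<equiv> power_map m Z c"

abbreviation "\<eta> \<sigma> \<equiv> wd_eta (wpp m Z c \<sigma>)"

text \<open>The laws of a power couple are stated for exponents \<open>\<ge> 1\<close>, so they apply to quotients of values
  of \<open>c\<close> once these are known to be positive.\<close>

lemma exponent_ge_1:
  assumes "\<tau> \<subseteq> \<sigma>" "\<sigma> \<subseteq> {1..m}" "i \<in> {1..m}"
  shows "c \<sigma> i div c \<tau> i \<ge> 1"
proof -
  have "c \<tau> i dvd c \<sigma> i" "c \<sigma> i \<ge> 1"
    using sequence assms by (auto simp: power_sequence_def)
  then show ?thesis
    by (auto elim!: dvdE)
qed

lemma exponent_mult:
  assumes "\<tau> \<subseteq> \<tau>'" "\<tau>' \<subseteq> \<sigma>" "\<sigma> \<subseteq> {1..m}" "i \<in> {1..m}"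
  shows "(c \<tau>' i div c \<tau> i) * (c \<sigma> i div c \<tau>' i) = c \<sigma> i div c \<tau> i"
proof -
  have "c \<tau> i dvd c \<tau>' i" "c \<tau>' i dvd c \<sigma> i"
    using sequence assms by (auto simp: power_sequence_def)
  then show ?thesis
    using exponent_ge_1[of \<tau>' \<tau>' i] assms by (auto elim!: dvdE)
qed

lemma pow_couple:
  assumes "a \<ge> 1" "i \<in> {1..m}"
  shows "pointed_map (pc_space (Z i)) (pc_space (Z i)) (pc_pow (Z i) a)"
    and "x \<in> pc_sub (Z i) \<Longrightarrow> pc_pow (Z i) a x \<in> pc_sub (Z i)"
    and "x \<in> topspace (fst (pc_space (Z i))) \<Longrightarrow> pc_pow (Z i) a x \<in> topspace (fst (pc_space (Z i)))"
  using couple[OF assms(2)] assms(1) unfolding is_power_couple_def pointed_map_def continuous_map_def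
  by blast+

lemma topspace_pc_product: "topspace (fst (pc_product m Z)) = (\<Pi>\<^sub>E i\<in>{1..m}. topspace (fst (pc_space (Z i))))"
  by (simp add: pc_product_def pointed_product_def topspace_cg_product)

lemma power_map_in_poly_points:
  assumes "\<tau> \<subseteq> \<sigma>" "\<sigma> \<subseteq> {1..m}" "z \<in> poly_points m Z K"
  shows "\<rho> \<sigma> \<tau> z \<in> poly_points m Z K"
proof -
  obtain \<tau>' where z: "z \<in> (\<Pi>\<^sub>E i\<in>{1..m}. topspace (fst (pc_space (Z i))))" "\<tau>' \<in> K"
      "\<forall>i\<in>{1..m} - \<tau>'. z i \<in> pc_sub (Z i)"
    using assms(3) by (auto simp: poly_points_def topspace_pc_product)
  have "\<rho> \<sigma> \<tau> z \<in> (\<Pi>\<^sub>E i\<in>{1..m}. topspace (fst (pc_space (Z i))))"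
    using z(1) pow_couple(3)[OF exponent_ge_1[OF assms(1,2)]] by (simp add: power_map_def PiE_iff)
  moreover have "\<forall>i\<in>{1..m} - \<tau>'. \<rho> \<sigma> \<tau> z i \<in> pc_sub (Z i)"
    using z(3) pow_couple(2)[OF exponent_ge_1[OF assms(1,2)]] by (simp add: power_map_def)
  ultimately show ?thesis
    using z(2) by (auto simp: poly_points_def topspace_pc_product)
qed

lemma power_map_power_map:
  assumes "\<tau> \<subseteq> \<tau>'" "\<tau>' \<subseteq> \<sigma>" "\<sigma> \<subseteq> {1..m}" "z \<in> poly_points m Z K"
  shows "\<rho> \<tau>' \<tau> (\<rho> \<sigma> \<tau>' z) = \<rho> \<sigma> \<tau> z"
proof -
  have "pc_pow (Z i) (c \<tau>' i div c \<tau> i) (pc_pow (Z i) (c \<sigma> i div c \<tau>' i) (z i)) =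
        pc_pow (Z i) (c \<sigma> i div c \<tau> i) (z i)" if i: "i \<in> {1..m}" for i
  proof -
    have "z i \<in> topspace (fst (pc_space (Z i)))"
      using assms(4) i by (auto simp: poly_points_def topspace_pc_product)
    moreover have "c \<tau>' i div c \<tau> i \<ge> 1" "c \<sigma> i div c \<tau>' i \<ge> 1"
      using assms i by (intro exponent_ge_1; auto)+
    ultimately show ?thesis
      using couple[OF i] exponent_mult[OF assms(1-3) i] unfolding is_power_couple_def by metis
  qed
  then show ?thesis
    by (simp add: power_map_def fun_eq_iff)
qed

lemma continuous_map_power_map:
  assumes "\<tau> \<subseteq> \<sigma>" "\<sigma> \<subseteq> {1..m}"
  shows "continuous_map (poly_product m Z K) (poly_product m Z K) (\<rho> \<sigma> \<tau>)"
proof -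
  let ?P = "product_topology (\<lambda>i. fst (pc_space (Z i))) {1..m}"
  have "continuous_map ?P ?P (\<rho> \<sigma> \<tau>)"
    unfolding continuous_map_componentwise
  proof (intro conjI ballI)
    fix i assume i: "i \<in> {1..m}"
    have "continuous_map ?P (fst (pc_space (Z i))) (pc_pow (Z i) (c \<sigma> i div c \<tau> i) \<circ> (\<lambda>z. z i))"
      using pow_couple(1)[OF exponent_ge_1[OF assms i] i] i unfolding pointed_map_def
      by (blast intro: continuous_map_compose continuous_map_product_projection)
    then show "continuous_map ?P (fst (pc_space (Z i))) (\<lambda>z. \<rho> \<sigma> \<tau> z i)"
      using i by (simp add: power_map_def o_def)
  qed (auto simp: power_map_def)
  then have "continuous_map (fst (pc_product m Z)) (fst (pc_product m Z)) (\<rho> \<sigma> \<tau>)"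
    by (simp add: pc_product_def pointed_product_def cg_product_def continuous_map_kification)
  then show ?thesis
    using power_map_in_poly_points[OF assms] unfolding poly_product_def cg_subspace_def
    by (intro continuous_map_kification continuous_map_into_subtopology continuous_map_from_subtopology) auto
qed

lemma wd_eta_in_topspace:
  "finite \<sigma> \<Longrightarrow> z \<in> poly_points m Z {\<sigma>} \<Longrightarrow> \<eta> \<sigma> z \<in> topspace (wd_space (wpp m Z c \<sigma>))"
  using continuous_map_wd_eta[of \<sigma> m Z c] unfolding continuous_map_def topspace_poly_product by blast

lemma poly_points_mono: "z \<in> poly_points m Z {\<tau>} \<Longrightarrow> \<tau> \<in> K \<Longrightarrow> z \<in> poly_points m Z K"
  by (auto simp: poly_points_def)

text \<open>The defining property of \<open>\<eta>(\<partial>\<sigma>)\<close>. Two faces whose products contain \<open>z\<close> are compared through the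
  smallest such face, the set of indices \<open>i\<close> with \<open>z i\<close> outside \<open>A\<^sub>i\<close>.\<close>

proposition eta_bd_face:
  assumes "\<sigma> \<subseteq> {1..m}" "\<tau> \<subset> \<sigma>" "z \<in> poly_points m Z {\<tau>}"
  shows "eta_bd m Z c \<sigma> z = bd_in (wpp m Z c) \<sigma> \<tau> (\<eta> \<tau> (\<rho> \<sigma> \<tau> z))"
proof -
  have "finite \<sigma>"
    using assms(1) finite_subset by blast
  then show ?thesis
    using assms
  proof (induction \<sigma> arbitrary: \<tau> z rule: finite_psubset_induct)
    case (psubset \<sigma>)
    let ?v = "\<lambda>\<tau>. bd_in (wpp m Z c) \<sigma> \<tau> (\<eta> \<tau> (\<rho> \<sigma> \<tau> z))"
    have smaller: "?v \<tau> = ?v \<tau>'"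
      if "\<tau>' \<subseteq> \<tau>" "\<tau> \<subset> \<sigma>" "z \<in> poly_points m Z {\<tau>'}" for \<tau> \<tau>'
    proof (cases "\<tau>' = \<tau>")
      case False
      have sub: "\<tau>' \<subset> \<tau>" "\<tau> \<subseteq> {1..m}"
        using that False psubset.prems by auto
      then have fin: "finite \<tau>" "finite \<tau>'"
        using finite_subset[of _ "{1..m}"] by auto
      have z: "\<rho> \<sigma> \<tau> z \<in> poly_points m Z {\<tau>'}" "\<rho> \<sigma> \<tau>' z \<in> poly_points m Z {\<tau>'}"
        using that(1,2) by (auto intro!: power_map_in_poly_points[OF _ psubset.prems(1) that(3)])
      have "eta_bd m Z c \<tau> (\<rho> \<sigma> \<tau> z) = bd_in (wpp m Z c) \<tau> \<tau>' (\<eta> \<tau>' (\<rho> \<tau> \<tau>' (\<rho> \<sigma> \<tau> z)))"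
        by (rule psubset.IH[OF that(2) sub(2) sub(1) z(1)])
      also have "\<rho> \<tau> \<tau>' (\<rho> \<sigma> \<tau> z) = \<rho> \<sigma> \<tau>' z"
        using that psubset.prems by (intro power_map_power_map) auto
      finally have "\<eta> \<tau> (\<rho> \<sigma> \<tau> z) = wd_trans (wpp m Z c \<tau>) \<tau>' (\<eta> \<tau>' (\<rho> \<sigma> \<tau>' z))"
        using poly_points_mono[OF z(1), of "bd \<tau>"] sub(1) by (intro wd_eta_boundary[OF fin(1) sub(1)]) (simp_all add: bd_def)
      then show ?thesis
        using bd_in_wd_trans[of \<tau>' \<tau> \<sigma> "\<eta> \<tau>' (\<rho> \<sigma> \<tau>' z)" "wpp m Z c"] sub(1) that(2)
          wd_eta_in_topspace[OF fin(2) z(2)] by simp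
    qed simp
    define supp where "supp = {i\<in>{1..m}. z i \<notin> pc_sub (Z i)}"
    have supp_least: "supp \<subseteq> \<tau>'" if "z \<in> poly_points m Z {\<tau>'}" for \<tau>'
      using that by (auto simp: supp_def poly_points_def)
    have supp_z: "z \<in> poly_points m Z {supp}"
      using psubset.prems(3) by (auto simp: supp_def poly_points_def)
    have to_supp: "?v \<tau>' = ?v supp" if "\<tau>' \<subset> \<sigma>" "z \<in> poly_points m Z {\<tau>'}" for \<tau>'
      by (rule smaller[OF supp_least[OF that(2)] that(1) supp_z])
    have "?v \<tau> = ?v \<tau>'" if "\<tau>' \<subset> \<sigma>" "z \<in> poly_points m Z {\<tau>'}" for \<tau>'
      using to_supp[OF that] to_supp[OF psubset.prems(2,3)] by simp
    then have agree: "\<forall>\<tau>'\<in>bd \<sigma>. z \<in> poly_points m Z {\<tau>'} \<longrightarrow> ?v \<tau> = ?v \<tau>'"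
      unfolding bd_def by blast
    have unique: "v = ?v \<tau>" if "\<forall>\<tau>'\<in>bd \<sigma>. z \<in> poly_points m Z {\<tau>'} \<longrightarrow> v = ?v \<tau>'" for v
      using that psubset.prems(2,3) unfolding bd_def by blast
    show ?case
      unfolding eta_bd_def bd_eta_def by (rule the_equality) (fact agree, rule unique)
  qed
qed

end


section \<open>The higher Whitehead product\<close>

text \<open>Since \<open>A\<^sub>i\<close> contains the basepoint, the fat wedge maps into \<open>(Z,A)\<^bsup>\<partial>\<sigma>\<^esup>\<close>, its face \<open>\<tau>\<close> going to
  \<open>(Z,A)\<^bsup>\<tau>\<^esup>\<close>. There \<open>\<eta>(\<partial>\<sigma>)\<close> is the composite of the continuous maps \<open>c\<^bsup>\<sigma>/\<tau>\<^esup>\<close>, \<open>\<eta>(\<tau>)\<close> and the map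
  into the colimit.\<close>

lemma (in weighted_couples) continuous_map_eta_bd_fat_wedge:
  assumes \<sigma>: "\<sigma> \<subseteq> {1..m}"
  shows "continuous_map (fst (fat_wedge \<sigma> (\<lambda>i. pc_space (Z i)))) (bd_space (wpp m Z c) \<sigma>)
    (eta_bd m Z c \<sigma> \<circ> fat_wedge_incl m Z \<sigma>)"
proof (rule continuous_map_fat_wedge)
  let ?B = "\<lambda>i. pc_space (Z i)"
  let ?P = "cg_product \<sigma> (\<lambda>i. fst (?B i))" and ?j = "fat_wedge_incl m Z \<sigma>"
  show "finite \<sigma>"
    using \<sigma> finite_subset by blast
  show "pointed_space (?B i)" if "i \<in> \<sigma>" for i
    using couple[of i] \<sigma> that by (auto simp: is_power_couple_def)
  fix \<tau> assume \<tau>: "\<tau> \<subset> \<sigma>"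
  then have "finite \<tau>"
    using \<sigma> finite_subset[of \<tau> "{1..m}"] by auto
  define j where "j = ?j \<circ> face_retraction \<sigma> ?B \<tau>"
  have j: "j z = (\<lambda>i\<in>{1..m}. if i \<in> \<tau> then z i else snd (?B i))" for z
    using \<tau> by (auto simp: j_def fat_wedge_incl_def face_retraction_def fun_eq_iff)
  have base: "snd (?B i) \<in> topspace (fst (?B i))" "snd (?B i) \<in> pc_sub (Z i)" if "i \<in> {1..m}" for i
    using couple[OF that] by (simp_all add: is_power_couple_def pointed_space_def)
  have j_in: "j z \<in> poly_points m Z {\<tau>}" if "z \<in> topspace ?P" for z
  proof -
    have "z i \<in> topspace (fst (?B i))" if "i \<in> \<tau>" for i
      using \<open>z \<in> topspace ?P\<close> \<tau> that by (auto simp: topspace_cg_product)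
    then show ?thesis
      using base by (simp add: j poly_points_def topspace_pc_product)
  qed
  have "continuous_map ?P (product_topology (\<lambda>i. fst (?B i)) {1..m}) j"
    unfolding continuous_map_componentwise
  proof (intro conjI ballI)
    fix i assume i: "i \<in> {1..m}"
    show "continuous_map ?P (fst (?B i)) (\<lambda>z. j z i)"
      using i \<tau> base(1)[OF i] by (cases "i \<in> \<tau>") (auto simp: j intro!: continuous_map_cg_product_projection)
  qed (auto simp: j)
  then have "continuous_map ?P (fst (pc_product m Z)) j"
    unfolding pc_product_def pointed_product_def fst_conv cg_product_def[of "{1..m}"]
    by (subst continuous_map_into_kification) (auto simp: cg_product_def)
  then have "continuous_map ?P (subtopology (fst (pc_product m Z)) (poly_points m Z {\<tau>})) j"
    using j_in by (intro continuous_map_into_subtopology) auto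
  then have "continuous_map ?P (poly_product m Z {\<tau>}) j"
    unfolding poly_product_def cg_subspace_def
    by (subst continuous_map_into_kification) (auto simp: cg_product_def)
  then have "continuous_map ?P (poly_product m Z {\<tau>}) (\<rho> \<sigma> \<tau> \<circ> j)"
    by (rule continuous_map_compose) (rule continuous_map_power_map[OF psubset_imp_subset[OF \<tau>] \<sigma>])
  then have "continuous_map ?P (wd_space (wpp m Z c \<tau>)) (\<eta> \<tau> \<circ> (\<rho> \<sigma> \<tau> \<circ> j))"
    by (rule continuous_map_compose) (rule continuous_map_wd_eta[OF \<open>finite \<tau>\<close>])
  then have "continuous_map ?P (bd_space (wpp m Z c) \<sigma>) (bd_in (wpp m Z c) \<sigma> \<tau> \<circ> (\<eta> \<tau> \<circ> (\<rho> \<sigma> \<tau> \<circ> j)))"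
    by (rule continuous_map_compose) (rule continuous_map_bd_in[OF \<tau>])
  moreover have "(bd_in (wpp m Z c) \<sigma> \<tau> \<circ> (\<eta> \<tau> \<circ> (\<rho> \<sigma> \<tau> \<circ> j))) z =
      (eta_bd m Z c \<sigma> \<circ> ?j \<circ> face_retraction \<sigma> ?B \<tau>) z" if "z \<in> topspace ?P" for z
    using eta_bd_face[OF \<sigma> \<tau> j_in[OF that]] by (simp add: j_def)
  ultimately show "continuous_map ?P (bd_space (wpp m Z c) \<sigma>)
      (eta_bd m Z c \<sigma> \<circ> ?j \<circ> face_retraction \<sigma> ?B \<tau>)"
    by (rule continuous_map_eq)
qed

theorem lemma3p3:
  fixes m :: nat and X :: "nat \<Rightarrow> 'a pointed" and \<sigma> :: "nat set"
    and c :: "nat set \<Rightarrow> nat \<Rightarrow> nat"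
    and \<phi> :: "complex list \<times> (nat \<Rightarrow> 'a) \<Rightarrow> nat \<Rightarrow> complex \<times> 'a"
  assumes "\<And>i. i \<in> {1..m} \<Longrightarrow> pointed_space (X i)"
    and "\<sigma> \<subseteq> {1..m}" and "card \<sigma> \<ge> 2"
    and "power_sequence m c"
    and "\<And>i. i \<in> \<sigma> \<Longrightarrow> c {i} i = 1"
    and "universal_whitehead_product \<sigma> X \<phi>"
  shows "eta_bd m (\<lambda>i. susp_couple (X i)) c \<sigma> \<circ> fat_wedge_incl m (\<lambda>i. susp_couple (X i)) \<sigma> \<circ> \<phi>
    \<in> higher_whitehead_products \<sigma> X \<phi> (wpp_bd m (\<lambda>i. susp_couple (X i)) c \<sigma>)
        (\<lambda>i. iota m (\<lambda>i. susp_couple (X i)) c \<sigma> i \<circ> pc_pow (susp_couple (X i)) (c \<sigma> i))"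
proof -
  let ?Z = "\<lambda>i. susp_couple (X i)"
  interpret weighted_couples m ?Z c
    using assms by unfold_locales (auto intro: is_power_couple_susp_couple)
  have space: "pc_space (?Z i) = susp (X i)" and sub: "pc_sub (?Z i) = {snd (susp (X i))}" for i
    by (simp_all add: susp_couple_def)
  let ?f = "eta_bd m ?Z c \<sigma> \<circ> fat_wedge_incl m ?Z \<sigma>"
  have base: "snd (susp (X i)) \<in> topspace (fst (susp (X i)))" if "i \<in> {1..m}" for i
    using pointed_space_susp[OF assms(1)[OF that]] by (simp add: pointed_space_def)
  have pow_base: "pc_pow (?Z i) a (snd (susp (X i))) = snd (susp (X i))" for i a
    by (simp add: susp_couple_def susp_def smash_def smash_pt_def collapse_def circle_def)
  have axis_in: "coord_axis {1..m} (\<lambda>j. susp (X j)) i y \<in> poly_points m ?Z {{i}}"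
    if "y \<in> topspace (fst (susp (X i)))" for i y
    using that base by (auto simp: coord_axis_def poly_points_def topspace_pc_product space sub)
  have base_in: "snd (pc_product m ?Z) \<in> poly_points m ?Z {{}}"
    using base by (auto simp: poly_points_def topspace_pc_product space sub) (auto simp: pc_product_def pointed_product_def space)
  have "pointed_map (fat_wedge \<sigma> (\<lambda>i. susp (X i))) (wpp_bd m ?Z c \<sigma>) ?f"
  proof -
    have "fat_wedge_incl m ?Z \<sigma> (snd (fat_wedge \<sigma> (\<lambda>i. susp (X i)))) = snd (pc_product m ?Z)"
      using assms(2) by (auto simp: fat_wedge_incl_def fat_wedge_def pointed_product_def pc_product_def Let_def space fun_eq_iff)
    moreover have "{} \<subset> \<sigma>"
      using assms(3) by auto
    moreover have "\<rho> \<sigma> {} (snd (pc_product m ?Z)) = snd (pc_product m ?Z)"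
      by (auto simp: power_map_def pc_product_def pointed_product_def space pow_base)
    ultimately have "?f (snd (fat_wedge \<sigma> (\<lambda>i. susp (X i)))) = snd (wpp_bd m ?Z c \<sigma>)"
      using eta_bd_face[OF assms(2) _ base_in] by (simp add: wpp_bd_def)
    then show ?thesis
      using continuous_map_eta_bd_fat_wedge[OF assms(2)]
      by (simp add: pointed_map_def wpp_bd_def space)
  qed
  moreover have "?f (coord_axis \<sigma> (\<lambda>i. susp (X i)) i y) = (iota m ?Z c \<sigma> i \<circ> pc_pow (?Z i) (c \<sigma> i)) y"
    if i: "i \<in> \<sigma>" and y: "y \<in> topspace (fst (susp (X i)))" for i y
  proof -
    let ?a = "coord_axis {1..m} (\<lambda>j. susp (X j)) i"
    \<comment> \<open>Since \<open>\<sigma>\<close> has at least two elements, the axis is a proper face.\<close>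
    have "{i} \<noteq> \<sigma>"
      using assms(3) by auto
    then have face: "{i} \<subset> \<sigma>"
      using i by blast
    have "fat_wedge_incl m ?Z \<sigma> (coord_axis \<sigma> (\<lambda>i. susp (X i)) i y) = ?a y"
      using i by (auto simp: fat_wedge_incl_def coord_axis_def space fun_eq_iff)
    moreover have "\<rho> \<sigma> {i} (?a y) = ?a (pc_pow (?Z i) (c \<sigma> i) y)"
      using assms(5)[OF i] by (auto simp: power_map_def coord_axis_def pow_base fun_eq_iff)
    ultimately show ?thesis
      using eta_bd_face[OF assms(2) face axis_in[OF y]] by (simp add: iota_def space)
  qed
  ultimately show ?thesis
    unfolding higher_whitehead_products_def by blast
qed

end
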